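(* Let $(X,d)$ be a complete, locally compact $\mathrm{CAT}(0)$ space with the geodesic extension property. If $C,D\subseteq X$ are nonempty, convex, closed, and disjoint, and at least one of them is bounded, then there exist $x\in C$ and $([\gamma],1),([\eta],1)\in T_xX$ opposite to each other such that $$\sup\{\langle([\gamma],1),([\gamma^y],d(x,y))\rangle \mid y\in D\}<0$$ and $$\sup\{\langle([\eta],1),([\gamma^y],d(x,y))\rangle\mid y\in C\}\le 0,$$ where $\gamma^y$ denotes the geodesic from $x$ to $y$.
   Context: A geodesic is an isometric map $\gamma:[0,l]\to X$; it issues at $\gamma(0)$. A $\mathrm{CAT}(0)$ space is a geodesic metric space whose geodesic triangles are not thicker than their comparison triangles in $\mathbb{R}^2$; it is uniquely geodesic. $C\subseteq X$ is convex if it contains every geodesic segment joining two of its points. $X$ has the geodesic extension property if every geodesic segment not reduced to a point is contained in a geodesic line (the image of an isometric map $\mathbb{R}\to X$). For $x\in X$, $\Sigma_xX$ is the set of equivalence classes $[\gamma]$ of nonconstant geodesics issuing at $x$, where $\gamma\sim\eta$ iff the Alexandrov angle $\angle(\gamma,\eta)$ is $0$. The tangent space $T_xX$ is the Euclidean cone over $(\Sigma_xX,\angle)$: its elements are pairs $([\gamma],r)$ with $[\gamma]\in\Sigma_xX$, $r\ge0$, all pairs with $r=0$ being identified to one point $o_x$, the origin (for $o_x$ the geodesic may also be taken constantly equal to $x$; in particular $([\gamma^x],d(x,x))=o_x$). The scalar product is $\langle([\gamma],r),([\eta],s)\rangle=rs\cos\angle(\gamma,\eta)$, equal to $0$ if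 $r=0$ or $s=0$. Elements $([\gamma],r),([\eta],s)\in T_xX$ are opposite to each other if $r=s=0$, or $r=s>0$ and $\angle(\gamma,\eta)=\pi$. *)

theory Defs
  imports "HOL-Analysis.Analysis"
begin

section \<open>Geodesics and CAT(0) spaces\<close>

text \<open>The ambient metric space \<open>X\<close> is the whole type \<open>'a :: metric_space\<close>.
  A geodesic \<open>\<gamma> : [0,l] \<rightarrow> X\<close> is represented by the pair \<open>(l, \<gamma>)\<close>; the values of \<open>\<gamma>\<close>
  outside \<open>[0,l]\<close> are irrelevant.\<close>

type_synonym 'a path_pair = "real \<times> (real \<Rightarrow> 'a)"

definition geodesic :: "real \<Rightarrow> (real \<Rightarrow> 'a::metric_space) \<Rightarrow> bool" where
  "geodesic l \<gamma> \<longleftrightarrow> 0 \<le> l \<and> (\<forall>s\<in>{0..l}. \<forall>t\<in>{0..l}. dist (\<gamma> s) (\<gamma> t) = \<bar>s - t\<bar>)"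

definition geodesic_segment :: "'a::metric_space set \<Rightarrow> 'a \<Rightarrow> 'a \<Rightarrow> bool" where
  "geodesic_segment S a b \<longleftrightarrow>
     (\<exists>l \<gamma>. geodesic l \<gamma> \<and> \<gamma> 0 = a \<and> \<gamma> l = b \<and> S = \<gamma> ` {0..l})"

definition geodesic_line :: "'a::metric_space set \<Rightarrow> bool" where
  "geodesic_line L \<longleftrightarrow> (\<exists>c :: real \<Rightarrow> 'a. (\<forall>s t. dist (c s) (c t) = \<bar>s - t\<bar>) \<and> L = range c)"

definition geodesically_convex :: "'a::metric_space set \<Rightarrow> bool" where
  "geodesically_convex C \<longleftrightarrow> (\<forall>a\<in>C. \<forall>b\<in>C. \<forall>S. geodesic_segment S a b \<longrightarrow> S \<subseteq> C)"

definition geodesic_extension_property :: "'a::metric_space itself \<Rightarrow> bool" where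
  "geodesic_extension_property (T :: 'a itself) \<longleftrightarrow>
     (\<forall>S (a::'a) b. geodesic_segment S a b \<and> a \<noteq> b \<longrightarrow> (\<exists>L. geodesic_line L \<and> S \<subseteq> L))"

text \<open>The points \<open>p', q', r'\<close> form a comparison triangle of \<open>p, q, r\<close>, and \<open>x', y'\<close> are the
  comparison points of \<open>x \<in> [p,q]\<close> and \<open>y \<in> [p,r]\<close>. Since \<open>p, q, r\<close> are arbitrary and
  geodesic segments can be reversed, this covers every pair of sides; for two points on the
  same side the inequality is trivially an equality.\<close>

definition CAT0 :: "'a::metric_space itself \<Rightarrow> bool" where
  "CAT0 (T :: 'a itself) \<longleftrightarrow>
     (\<forall>a b :: 'a. \<exists>S. geodesic_segment S a b) \<and>
     (\<forall>(p::'a) q r A B (p'::real^2) q' r'.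
        geodesic_segment A p q \<and> geodesic_segment B p r \<and>
        dist p' q' = dist p q \<and> dist p' r' = dist p r \<and> dist q' r' = dist q r \<longrightarrow>
        (\<forall>x\<in>A. \<forall>y\<in>B. \<forall>x'\<in>closed_segment p' q'. \<forall>y'\<in>closed_segment p' r'.
           dist p' x' = dist p x \<and> dist p' y' = dist p y \<longrightarrow> dist x y \<le> dist x' y'))"


section \<open>Alexandrov angles\<close>

text \<open>The angle at \<open>p'\<close> of a Euclidean comparison triangle, by the law of cosines.\<close>

definition comparison_angle :: "'a::metric_space \<Rightarrow> 'a \<Rightarrow> 'a \<Rightarrow> real" where
  "comparison_angle p q r =
     arccos (((dist p q)\<^sup>2 + (dist p r)\<^sup>2 - (dist q r)\<^sup>2) / (2 * dist p q * dist p r))"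

lemma comparison_angle_eq_euclidean_angle:
  fixes p q r :: "'a::metric_space" and p' q' r' :: "real^2"
  assumes "dist p' q' = dist p q" "dist p' r' = dist p r" "dist q' r' = dist q r"
  shows "comparison_angle p q r =
    arccos (((q' - p') \<bullet> (r' - p')) / (norm (q' - p') * norm (r' - p')))"
proof -
  have "(dist q' r')\<^sup>2 = (norm ((q' - p') - (r' - p')))\<^sup>2"
    by (simp add: dist_norm)
  also have "\<dots> = (norm (q' - p'))\<^sup>2 + (norm (r' - p'))\<^sup>2 - 2 * ((q' - p') \<bullet> (r' - p'))"
    by (simp add: power2_norm_eq_inner inner_diff_left inner_diff_right inner_commute)
  finally have *: "(norm (q' - p'))\<^sup>2 + (norm (r' - p'))\<^sup>2 - (dist q r)\<^sup>2
      = 2 * ((q' - p') \<bullet> (r' - p'))"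
    using assms by simp
  have "dist p q = norm (q' - p')" "dist p r = norm (r' - p')"
    using assms by (metis dist_commute dist_norm)+
  with * show ?thesis
    unfolding comparison_angle_def by (simp add: mult.assoc)
qed

text \<open>The upper limit of the comparison angles as \<open>s, t \<rightarrow> 0\<close> independently.\<close>

definition alexandrov_angle :: "(real \<Rightarrow> 'a::metric_space) \<Rightarrow> (real \<Rightarrow> 'a) \<Rightarrow> real" where
  "alexandrov_angle \<gamma> \<eta> =
     real_of_ereal (Limsup (at_right 0 \<times>\<^sub>F at_right 0)
       (\<lambda>(s, t). ereal (comparison_angle (\<gamma> 0) (\<gamma> s) (\<eta> t))))"


section \<open>Directions and tangent spaces\<close>

definition nonconstant_geodesics :: "'a::metric_space \<Rightarrow> 'a path_pair set" where
  "nonconstant_geodesics x = {(l, \<gamma>). 0 < l \<and> geodesic l \<gamma> \<and> \<gamma> 0 = x}"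

definition same_direction :: "'a::metric_space \<Rightarrow> ('a path_pair \<times> 'a path_pair) set" where
  "same_direction x =
     {(g, h). g \<in> nonconstant_geodesics x \<and> h \<in> nonconstant_geodesics x \<and>
              alexandrov_angle (snd g) (snd h) = 0}"

definition direction :: "'a::metric_space \<Rightarrow> 'a path_pair \<Rightarrow> 'a path_pair set" where
  "direction x g = same_direction x `` {g}"

definition space_of_directions :: "'a::metric_space \<Rightarrow> 'a path_pair set set" where
  "space_of_directions x = nonconstant_geodesics x // same_direction x"

text \<open>The common value of the angle on all representatives; it exists by the triangle
  inequality for Alexandrov angles.\<close>

definition direction_angle :: "'a::metric_space path_pair set \<Rightarrow> 'a path_pair set \<Rightarrow> real" where
  "direction_angle \<xi> \<zeta> = (THE a. \<forall>g\<in>\<xi>. \<forall>h\<in>\<zeta>. alexandrov_angle (snd g) (snd h) = a)"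

text \<open>In \<open>Ray \<xi> r\<close> the radius \<open>r\<close> is meant to be positive; all pairs of radius \<open>0\<close> are
  identified with \<open>Apex\<close>, whatever their first component.\<close>

datatype 'b cone_element = Apex | Ray 'b real

definition cone_pair :: "'b \<Rightarrow> real \<Rightarrow> 'b cone_element" where
  "cone_pair \<xi> r = (if r = 0 then Apex else Ray \<xi> r)"

text \<open>The apex is inserted explicitly so that the cone over the empty set is a point.\<close>

definition euclidean_cone :: "'b set \<Rightarrow> 'b cone_element set" where
  "euclidean_cone Y = insert Apex {cone_pair \<xi> r | \<xi> r. \<xi> \<in> Y \<and> 0 \<le> r}"

type_synonym 'a tangent_vector = "'a path_pair set cone_element"

definition tangent_space :: "'a::metric_space \<Rightarrow> 'a tangent_vector set" where
  "tangent_space x = euclidean_cone (space_of_directions x)"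

text \<open>The tangent vector \<open>([\<gamma>], r)\<close> at \<open>x\<close>; for \<open>r = 0\<close> it is the origin, also if \<open>\<gamma>\<close> is
  constant.\<close>

definition tangent_pair :: "'a::metric_space \<Rightarrow> 'a path_pair \<Rightarrow> real \<Rightarrow> 'a tangent_vector" where
  "tangent_pair x g r = cone_pair (direction x g) r"

fun tangent_product :: "'a::metric_space tangent_vector \<Rightarrow> 'a tangent_vector \<Rightarrow> real" where
  "tangent_product (Ray \<xi> r) (Ray \<zeta> s) = r * s * cos (direction_angle \<xi> \<zeta>)"
| "tangent_product Apex w = 0"
| "tangent_product v Apex = 0"

definition opposite :: "'a::metric_space tangent_vector \<Rightarrow> 'a tangent_vector \<Rightarrow> bool" where
  "opposite v w \<longleftrightarrow> (v = Apex \<and> w = Apex) \<or>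
     (\<exists>\<xi> \<zeta> r. 0 < r \<and> v = Ray \<xi> r \<and> w = Ray \<zeta> r \<and> direction_angle \<xi> \<zeta> = pi)"

text \<open>The geodesic from \<open>x\<close> to \<open>y\<close>. In a CAT(0) space it is unique on \<open>[0, dist x y]\<close>, and its
  length is necessarily \<open>dist x y\<close>; the choice only concerns irrelevant values.\<close>

definition geodesic_to :: "'a::metric_space \<Rightarrow> 'a \<Rightarrow> 'a path_pair" where
  "geodesic_to x y =
     (dist x y, SOME \<gamma>. geodesic (dist x y) \<gamma> \<and> \<gamma> 0 = x \<and> \<gamma> (dist x y) = y)"

end

theory Submission
  imports Defs
begin

text \<open>By the Hopf-Rinow theorem \<open>X\<close> is proper, so there are \<open>x \<in> C\<close> and \<open>z \<in> D\<close> at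
  minimal distance \<open>L > 0\<close>. Extend \<open>[x, z]\<close> to a line; \<open>\<eta>\<close> runs along it from \<open>x\<close> towards \<open>z\<close>
  and \<open>\<gamma>\<close> in the opposite direction. For \<open>y \<in> D\<close> the comparison triangle of \<open>x, z, y\<close> is not
  acute at the projection \<open>z\<close> of \<open>x\<close>, so \<open>\<langle>\<eta>, \<gamma>\<^sup>y\<rangle> \<ge> L\<close>, and the triangle inequality for angles
  gives \<open>\<langle>\<gamma>, \<gamma>\<^sup>y\<rangle> \<le> - L\<close>. For \<open>y \<in> C\<close>, \<open>x\<close> is the projection to \<open>C\<close> of every point of
  \<open>[x, z]\<close>, so all comparison angles in the definition of \<open>\<angle>(\<eta>, \<gamma>\<^sup>y)\<close> are at least
  \<open>\<pi>/2\<close>.\<close>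

section \<open>Proper geodesic spaces\<close>

lemma geodesic_segment_obtain:
  assumes "geodesic_segment S a b"
  obtains \<gamma> where "geodesic (dist a b) \<gamma>" "\<gamma> 0 = a" "\<gamma> (dist a b) = b"
    "S = \<gamma> ` {0..dist a b}"
proof -
  obtain l \<gamma> where *: "geodesic l \<gamma>" "\<gamma> 0 = a" "\<gamma> l = b" "S = \<gamma> ` {0..l}"
    using assms unfolding geodesic_segment_def by blast
  then have "dist a b = l"
    unfolding geodesic_def by (metis abs_minus_commute abs_of_nonneg atLeastAtMost_iff diff_zero order_refl)
  with * that show ?thesis by blast
qed

lemma geodesic_dist:
  assumes "geodesic l \<gamma>" "0 \<le> s" "s \<le> l" "0 \<le> t" "t \<le> l"
  shows "dist (\<gamma> s) (\<gamma> t) = \<bar>s - t\<bar>"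
  using assms unfolding geodesic_def by simp

text \<open>The closed ball is complete, so only finite nets are needed. Moving back along the
  geodesic to \<open>p\<close> brings each of its points within \<open>d\<close> of the compact ball
  of radius \<open>R - d\<close>, so an e/2-net of the smaller ball is an e-net of the larger one up
  to its boundary.\<close>

lemma compact_cball_Sup:
  fixes p :: "'a::complete_space"
  assumes geo: "\<And>a b :: 'a. \<exists>S. geodesic_segment S a b"
    and R: "0 < R" and cpt: "\<And>r. 0 < r \<Longrightarrow> r < R \<Longrightarrow> compact (cball p r)"
  shows "compact (cball p R)"
  unfolding compact_eq_totally_bounded
proof (intro conjI allI impI)
  show "complete (cball p R)"
    by (simp add: complete_eq_closed)
next
  fix e :: real assume e: "e > 0"
  \<comment> \<open>The bound \<open>R / 2\<close> keeps \<open>R - d\<close> strictly between 0 and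
    \<open>R\<close>, where compactness is assumed.\<close>
  define d where "d = min (e / 2) (R / 2)"
  have d: "0 < d" "d \<le> e / 2" "d < R"
    using e R by (auto simp: d_def)
  have "compact (cball p (R - d))"
    using cpt d by simp
  then obtain k where k: "finite k" "cball p (R - d) \<subseteq> (\<Union>x\<in>k. ball x (e / 2))"
    using e unfolding compact_eq_totally_bounded by (meson half_gt_zero)
  have "cball p R \<subseteq> (\<Union>x\<in>k. ball x e)"
  proof
    fix y assume y: "y \<in> cball p R"
    obtain S where "geodesic_segment S p y" using geo by blast
    then obtain \<gamma> where g: "geodesic (dist p y) \<gamma>" "\<gamma> 0 = p" "\<gamma> (dist p y) = y"
      by (rule geodesic_segment_obtain)
    define t where "t = max 0 (dist p y - d)"
    have t: "0 \<le> t" "t \<le> dist p y" "dist p y - t \<le> d" "t \<le> R - d"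
      using y d by (auto simp: t_def)
    have "dist p (\<gamma> t) = t" "dist (\<gamma> t) y = dist p y - t"
      using geodesic_dist[OF g(1), of 0 t] geodesic_dist[OF g(1), of t "dist p y"] t g by auto
    then have "\<gamma> t \<in> cball p (R - d)" "dist (\<gamma> t) y \<le> e / 2"
      using t d by auto
    then obtain x where "x \<in> k" "dist x (\<gamma> t) < e / 2"
      using k(2) by auto
    moreover have "dist x y \<le> dist x (\<gamma> t) + dist (\<gamma> t) y"
      by (rule dist_triangle)
    ultimately have "dist x y < e"
      using \<open>dist (\<gamma> t) y \<le> e / 2\<close> by linarith
    then show "y \<in> (\<Union>x\<in>k. ball x e)"
      using \<open>x \<in> k\<close> by auto
  qed
  then show "\<exists>k. finite k \<and> cball p R \<subseteq> (\<Union>x\<in>k. ball x e)"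
    using k(1) by blast
qed

text \<open>Finitely many open sets with compact supersets cover the compact ball. Their union
  contains a uniform neighbourhood of the ball, and geodesics to \<open>p\<close> show that a
  slightly larger ball stays inside this neighbourhood.\<close>

lemma compact_cball_extend:
  fixes p :: "'a::metric_space"
  assumes geo: "\<And>a b :: 'a. \<exists>S. geodesic_segment S a b"
    and lc: "locally compact (UNIV :: 'a set)"
    and R: "0 \<le> R" and cpt: "compact (cball p R)"
  shows "\<exists>e>0. compact (cball p (R + e))"
proof -
  have "\<exists>U K. x \<in> U \<and> open U \<and> U \<subseteq> K \<and> compact K" for x :: 'a
  proof -
    have "openin (top_of_set UNIV) (UNIV :: 'a set)" "x \<in> UNIV" by simp_all
    then have "\<exists>U V. openin (top_of_set UNIV) U \<and> compact V \<and> x \<in> U \<and> U \<subseteq> V \<and> V \<subseteq> UNIV"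
      using lc unfolding locally_def by blast
    then show ?thesis by auto
  qed
  then obtain U K where UK: "\<And>x::'a. x \<in> U x \<and> open (U x) \<and> U x \<subseteq> K x \<and> compact (K x)"
    by metis
  obtain F where F: "F \<subseteq> cball p R" "finite F" "cball p R \<subseteq> (\<Union>x\<in>F. U x)"
    by (rule compactE_image[OF cpt, of "cball p R" U]) (use UK in blast)+
  define V where "V = (\<Union>x\<in>F. U x)"
  have VK: "open V" "V \<subseteq> (\<Union>x\<in>F. K x)" "compact (\<Union>x\<in>F. K x)"
    using UK F(2) unfolding V_def by blast+
  \<comment> \<open>Applied to the single open set \<open>V\<close>, the lemma yields a Lebesgue
    number. Half of it is used below, since a closed ball has to fit into open balls of radius
    \<open>e\<close>.\<close>
  obtain e where e: "e > 0" "\<And>x. x \<in> cball p R \<Longrightarrow> ball x e \<subseteq> V"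
    by (rule Heine_Borel_lemma[OF cpt, of "{V}"]) (use VK F(3) V_def in auto)
  have "cball p (R + e / 2) \<subseteq> V"
  proof
    fix y assume y: "y \<in> cball p (R + e / 2)"
    obtain S where "geodesic_segment S p y" using geo by blast
    then obtain \<gamma> where g: "geodesic (dist p y) \<gamma>" "\<gamma> 0 = p" "\<gamma> (dist p y) = y"
      by (rule geodesic_segment_obtain)
    define t where "t = min R (dist p y)"
    have t: "0 \<le> t" "t \<le> dist p y" "dist p y - t \<le> e / 2" "t \<le> R"
      using y e R by (auto simp: t_def)
    have "dist p (\<gamma> t) = t" "dist (\<gamma> t) y = dist p y - t"
      using geodesic_dist[OF g(1), of 0 t] geodesic_dist[OF g(1), of t "dist p y"] t g by auto
    then have "\<gamma> t \<in> cball p R" "y \<in> ball (\<gamma> t) e"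
      using t e by auto
    then show "y \<in> V" using e by blast
  qed
  then have "compact (cball p (R + e / 2))"
    using VK by (metis Int_absorb1 closed_cball compact_Int_closed subset_trans)
  then show ?thesis using e(1) by (intro exI[of _ "e / 2"]) auto
qed

text \<open>The radii of compact balls around \<open>p\<close> form an interval containing 0. If it
  were bounded, its supremum would belong to it by \<open>compact_cball_Sup\<close>, and
  \<open>compact_cball_extend\<close> would then exceed the supremum.\<close>

theorem Hopf_Rinow_compact_cball:
  fixes p :: "'a::complete_space"
  assumes geo: "\<And>a b :: 'a. \<exists>S. geodesic_segment S a b"
    and lc: "locally compact (UNIV :: 'a set)"
  shows "compact (cball p r)"
proof (rule ccontr)
  assume nc: "\<not> compact (cball p r)"
  define A where "A = {s. 0 \<le> s \<and> compact (cball p s)}"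
  have mono: "compact (cball p s)" if "compact (cball p t)" "s \<le> t" for s t
    using that by (metis Int_absorb1 closed_cball compact_Int_closed subset_cball)
  have bdd: "s \<le> r" if "s \<in> A" for s
    using that nc mono[of s r] unfolding A_def by force
  have "0 \<in> A" by (simp add: A_def)
  have bd: "bdd_above A" using bdd by (meson bdd_above.I)
  \<comment> \<open>Extending the one-point ball makes \<open>Sup A\<close> positive, as
    \<open>compact_cball_Sup\<close> requires.\<close>
  obtain e where "e > 0" "compact (cball p (0 + e))"
    using compact_cball_extend[OF geo lc, of 0 p] \<open>0 \<in> A\<close> unfolding A_def by blast
  then have "e \<in> A" by (simp add: A_def)
  then have S0: "0 < Sup A"
    using cSup_upper[OF _ bd] \<open>e > 0\<close> by fastforce
  have "compact (cball p s)" if "0 < s" "s < Sup A" for s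
    using less_cSup_iff[of A s] \<open>0 \<in> A\<close> bd that mono[of _ s] unfolding A_def by force
  then have "compact (cball p (Sup A))"
    using compact_cball_Sup[OF geo S0] by blast
  then obtain e' where "e' > 0" "compact (cball p (Sup A + e'))"
    using compact_cball_extend[OF geo lc, of "Sup A" p] S0 by auto
  then have "Sup A + e' \<in> A" using S0 by (simp add: A_def)
  then show False
    using cSup_upper[OF _ bd] \<open>e' > 0\<close> by fastforce
qed

section \<open>Closest points of two closed sets in a proper space\<close>

text \<open>Points of \<open>D\<close> farther than \<open>r + dist c d\<close> from
  \<open>c\<close> are farther than \<open>dist c d\<close> from all of \<open>C\<close>, so they
  cannot beat the pair \<open>(c, d)\<close>. What remains of \<open>D\<close> is compact, and a
  continuous function on a compact product attains its minimum.\<close>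

lemma closest_points_compact_closed:
  fixes C D :: "'a::metric_space set"
  assumes proper: "\<And>(p::'a) r. compact (cball p r)"
    and "compact C" "C \<noteq> {}" "closed D" "D \<noteq> {}"
  obtains x z where "x \<in> C" "z \<in> D" "\<And>x' z'. x' \<in> C \<Longrightarrow> z' \<in> D \<Longrightarrow> dist x z \<le> dist x' z'"
proof -
  obtain c d where cd: "c \<in> C" "d \<in> D" using assms by blast
  obtain r where r: "\<And>x. x \<in> C \<Longrightarrow> dist c x \<le> r"
    using compact_imp_bounded[OF assms(2)] bounded_any_center[of C c] by blast
  define D' where "D' = cball c (r + dist c d) \<inter> D"
  have D': "compact D'"
    unfolding D'_def using proper assms(4) by (simp add: compact_Int_closed)
  have "d \<in> D'"
    using cd r[of c] by (auto simp: D'_def)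
  have "continuous_on (C \<times> D') (\<lambda>u. dist (fst u) (snd u))"
    by (intro continuous_intros)
  then obtain u where u: "u \<in> C \<times> D'"
    "\<And>v. v \<in> C \<times> D' \<Longrightarrow> dist (fst u) (snd u) \<le> dist (fst v) (snd v)"
    using continuous_attains_inf[of "C \<times> D'" "\<lambda>u. dist (fst u) (snd u)"]
      compact_Times[OF assms(2) D'] cd(1) \<open>d \<in> D'\<close> by blast
  have "dist (fst u) (snd u) \<le> dist x' z'" if "x' \<in> C" "z' \<in> D" for x' z'
  proof (cases "z' \<in> D'")
    case True
    then show ?thesis using u(2)[of "(x', z')"] that by simp
  next
    case False
    then have "r + dist c d < dist c z'"
      using that by (auto simp: D'_def)
    moreover have "dist c z' \<le> dist c x' + dist x' z'"
      by (rule dist_triangle)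
    ultimately have "dist c d \<le> dist x' z'"
      using r[OF that(1)] by linarith
    then show ?thesis using u(2)[of "(c, d)"] cd \<open>d \<in> D'\<close> by simp
  qed
  then show ?thesis
    using that[of "fst u" "snd u"] u(1) by (auto simp: D'_def)
qed

lemma closest_points_bounded_closed:
  fixes C D :: "'a::metric_space set"
  assumes proper: "\<And>(p::'a) r. compact (cball p r)"
    and "closed C" "C \<noteq> {}" "closed D" "D \<noteq> {}" "bounded C \<or> bounded D"
  obtains x z where "x \<in> C" "z \<in> D" "\<And>x' z'. x' \<in> C \<Longrightarrow> z' \<in> D \<Longrightarrow> dist x z \<le> dist x' z'"
proof -
  have cpt: "compact E" if "closed E" "bounded E" for E :: "'a set"
    using that proper by (metis Int_absorb1 bounded_subset_cball compact_Int_closed)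
  from assms(6) show ?thesis
  proof
    assume "bounded C"
    then show ?thesis
      using closest_points_compact_closed[OF proper cpt[OF assms(2)] assms(3-5)] that by blast
  next
    assume "bounded D"
    then obtain z x where "z \<in> D" "x \<in> C" "\<And>z' x'. z' \<in> D \<Longrightarrow> x' \<in> C \<Longrightarrow> dist z x \<le> dist z' x'"
      using closest_points_compact_closed[OF proper cpt[OF assms(4)] assms(5,2,3)] by blast
    then show ?thesis
      using that[of x z] by (metis dist_commute)
  qed
qed

section \<open>Comparison angles\<close>

text \<open>The triangle inequalities place the argument of \<open>arccos\<close> in [-1, 1], so
  that \<open>cos\<close> inverts it.\<close>

lemma cos_comparison_angle:
  fixes p q r :: "'a::metric_space"
  assumes "p \<noteq> q" "p \<noteq> r"
  shows "cos (comparison_angle p q r) =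
      ((dist p q)\<^sup>2 + (dist p r)\<^sup>2 - (dist q r)\<^sup>2) / (2 * dist p q * dist p r)"
    and "0 \<le> comparison_angle p q r" "comparison_angle p q r \<le> pi"
proof -
  have pos: "0 < dist p q" "0 < dist p r" using assms by auto
  have "(dist q r)\<^sup>2 \<le> (dist p q + dist p r)\<^sup>2"
    by (rule power_mono) (use dist_triangle3[of q r p] in auto)
  moreover have "(dist p q - dist p r)\<^sup>2 \<le> (dist q r)\<^sup>2"
    unfolding abs_le_square_iff[symmetric]
    using dist_triangle[of p q r] dist_triangle[of p r q] by (simp add: dist_commute abs_le_iff)
  ultimately have "\<bar>(dist p q)\<^sup>2 + (dist p r)\<^sup>2 - (dist q r)\<^sup>2\<bar> \<le> 2 * dist p q * dist p r"
    by (simp add: abs_le_iff power2_sum power2_diff)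
  then have "\<bar>((dist p q)\<^sup>2 + (dist p r)\<^sup>2 - (dist q r)\<^sup>2) / (2 * dist p q * dist p r)\<bar> \<le> 1"
    using pos by (simp add: abs_mult)
  then have "- 1 \<le> ((dist p q)\<^sup>2 + (dist p r)\<^sup>2 - (dist q r)\<^sup>2) / (2 * dist p q * dist p r)"
    "((dist p q)\<^sup>2 + (dist p r)\<^sup>2 - (dist q r)\<^sup>2) / (2 * dist p q * dist p r) \<le> 1"
    unfolding abs_le_iff by linarith+
  then show "cos (comparison_angle p q r) =
      ((dist p q)\<^sup>2 + (dist p r)\<^sup>2 - (dist q r)\<^sup>2) / (2 * dist p q * dist p r)"
    "0 \<le> comparison_angle p q r" "comparison_angle p q r \<le> pi"
    unfolding comparison_angle_def
    by (simp_all only: cos_arccos arccos_lbound arccos_ubound)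
qed

lemma law_of_cosines_comparison:
  fixes p q r :: "'a::metric_space"
  assumes "p \<noteq> q" "p \<noteq> r"
  shows "(dist q r)\<^sup>2 = (dist p q)\<^sup>2 + (dist p r)\<^sup>2
    - 2 * dist p q * dist p r * cos (comparison_angle p q r)"
  using assms by (simp add: cos_comparison_angle)

text \<open>Cosine is decreasing on [0, pi]. This translates between bounds on angles and bounds on
  squared distances.\<close>

lemma comparison_angle_le_iff:
  fixes p q r :: "'a::metric_space"
  assumes "p \<noteq> q" "p \<noteq> r" "0 \<le> a" "a \<le> pi"
  shows "comparison_angle p q r \<le> a \<longleftrightarrow>
    (dist q r)\<^sup>2 \<le> (dist p q)\<^sup>2 + (dist p r)\<^sup>2 - 2 * dist p q * dist p r * cos a"
proof -
  have "comparison_angle p q r \<le> a \<longleftrightarrow> cos a \<le> cos (comparison_angle p q r)"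
    using assms(3,4) cos_comparison_angle(2,3)[OF assms(1,2)] by (simp add: cos_mono_le_eq)
  also have "\<dots> \<longleftrightarrow> 2 * dist p q * dist p r * cos a
      \<le> 2 * dist p q * dist p r * cos (comparison_angle p q r)"
    using assms by simp
  finally show ?thesis
    using law_of_cosines_comparison[OF assms(1,2)] by linarith
qed

lemma comparison_angle_commute: "comparison_angle p q r = comparison_angle p r q"
  unfolding comparison_angle_def by (simp add: dist_commute add.commute mult.assoc mult.left_commute mult.commute)

section \<open>Alexandrov angles\<close>

lemma eventually_at_right_0_prod:
  "eventually P (at_right 0 \<times>\<^sub>F at_right (0::real)) \<longleftrightarrow>
    (\<exists>e>0. \<forall>s t. 0 < s \<longrightarrow> s < e \<longrightarrow> 0 < t \<longrightarrow> t < e \<longrightarrow> P (s, t))"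
  unfolding eventually_prod_same eventually_at_right_field
proof
  assume "\<exists>Q. (\<exists>b>0. \<forall>y>0. y < b \<longrightarrow> Q y) \<and> (\<forall>x y. Q x \<longrightarrow> Q y \<longrightarrow> P (x, y))"
  then show "\<exists>e>0. \<forall>s t. 0 < s \<longrightarrow> s < e \<longrightarrow> 0 < t \<longrightarrow> t < e \<longrightarrow> P (s, t)"
    by metis
next
  assume "\<exists>e>0. \<forall>s t. 0 < s \<longrightarrow> s < e \<longrightarrow> 0 < t \<longrightarrow> t < e \<longrightarrow> P (s, t)"
  then obtain e where "e > 0"
    "\<forall>s t. 0 < s \<longrightarrow> s < e \<longrightarrow> 0 < t \<longrightarrow> t < e \<longrightarrow> P (s, t)" by blast
  then show "\<exists>Q. (\<exists>b>0. \<forall>y>0. y < b \<longrightarrow> Q y) \<and> (\<forall>x y. Q x \<longrightarrow> Q y \<longrightarrow> P (x, y))"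
    by (intro exI[of _ "\<lambda>s. 0 < s \<and> s < e"]) auto
qed

lemma nonconstant_geodesics_dist:
  assumes "(l, \<gamma>) \<in> nonconstant_geodesics x" "0 < s" "s \<le> l"
  shows "dist x (\<gamma> s) = s" "x \<noteq> \<gamma> s"
proof -
  have "geodesic l \<gamma>" "\<gamma> 0 = x"
    using assms unfolding nonconstant_geodesics_def by auto
  then show "dist x (\<gamma> s) = s"
    using geodesic_dist[of l \<gamma> 0 s] assms by auto
  then show "x \<noteq> \<gamma> s" using assms(2) by auto
qed

context
  fixes x :: "'a::metric_space" and g h :: "'a path_pair"
  assumes g: "g \<in> nonconstant_geodesics x" and h: "h \<in> nonconstant_geodesics x"
begin

text \<open>For small parameters the comparison angles lie in [0, pi]. The upper limit is therefore
  finite and \<open>real_of_ereal\<close> loses nothing.\<close>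

lemma alexandrov_angle_Limsup:
  "Limsup (at_right 0 \<times>\<^sub>F at_right 0)
      (\<lambda>(s, t). ereal (comparison_angle x (snd g s) (snd h t))) = ereal (alexandrov_angle (snd g) (snd h))"
  (is "?L = _")
  and alexandrov_angle_nonneg: "0 \<le> alexandrov_angle (snd g) (snd h)"
  and alexandrov_angle_le_pi: "alexandrov_angle (snd g) (snd h) \<le> pi"
proof -
  have g0: "snd g 0 = x" and l: "0 < min (fst g) (fst h)"
    using g h by (auto simp: nonconstant_geodesics_def)
  have "\<forall>\<^sub>F u in at_right 0 \<times>\<^sub>F at_right 0.
      0 \<le> comparison_angle x (snd g (fst u)) (snd h (snd u)) \<and>
      comparison_angle x (snd g (fst u)) (snd h (snd u)) \<le> pi"
    unfolding eventually_at_right_0_prod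
  proof (intro exI[of _ "min (fst g) (fst h)"] conjI[OF l] allI impI)
    fix s t assume "0 < s" "s < min (fst g) (fst h)" "0 < t" "t < min (fst g) (fst h)"
    then have "x \<noteq> snd g s" "x \<noteq> snd h t"
      using nonconstant_geodesics_dist(2)[of "fst g" "snd g" x s]
        nonconstant_geodesics_dist(2)[of "fst h" "snd h" x t] g h by auto
    then show "0 \<le> comparison_angle x (snd g (fst (s, t))) (snd h (snd (s, t))) \<and>
        comparison_angle x (snd g (fst (s, t))) (snd h (snd (s, t))) \<le> pi"
      by (simp add: cos_comparison_angle)
  qed
  then have ev: "\<forall>\<^sub>F u in at_right 0 \<times>\<^sub>F at_right 0.
      0 \<le> (\<lambda>(s, t). ereal (comparison_angle x (snd g s) (snd h t))) u"
    "\<forall>\<^sub>F u in at_right 0 \<times>\<^sub>F at_right 0.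
      (\<lambda>(s, t). ereal (comparison_angle x (snd g s) (snd h t))) u \<le> ereal pi"
    by (auto elim!: eventually_mono)
  have "0 \<le> ?L"
    by (rule le_Limsup[OF _ ev(1)]) (simp add: prod_filter_eq_bot)
  moreover have "?L \<le> ereal pi"
    by (rule Limsup_bounded[OF ev(2)])
  ultimately show "?L = ereal (alexandrov_angle (snd g) (snd h))"
    "0 \<le> alexandrov_angle (snd g) (snd h)" "alexandrov_angle (snd g) (snd h) \<le> pi"
    unfolding alexandrov_angle_def g0 by (cases ?L; auto)+
qed

lemma alexandrov_angle_leI:
  assumes "e > 0"
    and "\<And>s t. 0 < s \<Longrightarrow> s < e \<Longrightarrow> 0 < t \<Longrightarrow> t < e \<Longrightarrow> comparison_angle x (snd g s) (snd h t) \<le> a"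
  shows "alexandrov_angle (snd g) (snd h) \<le> a"
proof -
  have "Limsup (at_right 0 \<times>\<^sub>F at_right 0)
      (\<lambda>(s, t). ereal (comparison_angle x (snd g s) (snd h t))) \<le> ereal a"
    using assms by (intro Limsup_bounded) (auto simp: eventually_at_right_0_prod)
  then show ?thesis by (simp add: alexandrov_angle_Limsup)
qed

lemma alexandrov_angle_geI:
  assumes "e > 0"
    and "\<And>s t. 0 < s \<Longrightarrow> s < e \<Longrightarrow> 0 < t \<Longrightarrow> t < e \<Longrightarrow> a \<le> comparison_angle x (snd g s) (snd h t)"
  shows "a \<le> alexandrov_angle (snd g) (snd h)"
proof -
  have "ereal a \<le> Limsup (at_right 0 \<times>\<^sub>F at_right 0)
      (\<lambda>(s, t). ereal (comparison_angle x (snd g s) (snd h t)))"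
    using assms
    by (intro le_Limsup) (auto simp: eventually_at_right_0_prod prod_filter_eq_bot)
  then show ?thesis by (simp add: alexandrov_angle_Limsup)
qed

lemma alexandrov_angle_lessD:
  assumes "alexandrov_angle (snd g) (snd h) < a"
  obtains e where "e > 0"
    "\<And>s t. 0 < s \<Longrightarrow> s < e \<Longrightarrow> 0 < t \<Longrightarrow> t < e \<Longrightarrow> comparison_angle x (snd g s) (snd h t) < a"
proof -
  have "\<forall>\<^sub>F u in at_right 0 \<times>\<^sub>F at_right 0.
      (\<lambda>(s, t). ereal (comparison_angle x (snd g s) (snd h t))) u < ereal a"
    using assms by (intro Limsup_lessD) (simp add: alexandrov_angle_Limsup)
  then show ?thesis
    using that by (auto simp: eventually_at_right_0_prod)
qed

end

lemma alexandrov_angle_le_commute: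
  fixes x :: "'a::metric_space"
  assumes g: "g \<in> nonconstant_geodesics x" and h: "h \<in> nonconstant_geodesics x"
  shows "alexandrov_angle (snd h) (snd g) \<le> alexandrov_angle (snd g) (snd h)"
proof (rule field_le_epsilon)
  fix d :: real assume "d > 0"
  then obtain e where "e > 0"
    "\<And>s t. 0 < s \<Longrightarrow> s < e \<Longrightarrow> 0 < t \<Longrightarrow> t < e \<Longrightarrow>
      comparison_angle x (snd g s) (snd h t) < alexandrov_angle (snd g) (snd h) + d"
    using alexandrov_angle_lessD[OF g h, of "alexandrov_angle (snd g) (snd h) + d"] by auto
  then show "alexandrov_angle (snd h) (snd g) \<le> alexandrov_angle (snd g) (snd h) + d"
    by (intro alexandrov_angle_leI[OF h g]) (auto simp: comparison_angle_commute[of x "snd h _"] less_imp_le)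
qed

lemma alexandrov_angle_commute:
  fixes x :: "'a::metric_space"
  assumes "g \<in> nonconstant_geodesics x" "h \<in> nonconstant_geodesics x"
  shows "alexandrov_angle (snd g) (snd h) = alexandrov_angle (snd h) (snd g)"
  by (rule antisym; rule alexandrov_angle_le_commute; fact assms)

text \<open>Two points on one geodesic have distance \<open>\<bar>s - t\<bar>\<close>, so their
  comparison triangle with \<open>x\<close> is degenerate with angle 0.\<close>

lemma alexandrov_angle_self:
  fixes x :: "'a::metric_space"
  assumes g: "g \<in> nonconstant_geodesics x"
  shows "alexandrov_angle (snd g) (snd g) = 0"
proof -
  have l: "fst g > 0" using g by (auto simp: nonconstant_geodesics_def)
  have "comparison_angle x (snd g s) (snd g t) \<le> 0"
    if "0 < s" "s < fst g" "0 < t" "t < fst g" for s t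
  proof -
    have "dist (snd g s) (snd g t) = \<bar>s - t\<bar>"
      using g that geodesic_dist[of "fst g" "snd g" s t] by (auto simp: nonconstant_geodesics_def)
    then show ?thesis
      using nonconstant_geodesics_dist[of "fst g" "snd g" x] g that
      by (subst comparison_angle_le_iff) (auto simp: power2_diff)
  qed
  from alexandrov_angle_leI[OF g g l this] alexandrov_angle_nonneg[OF g g]
  show ?thesis by simp
qed

section \<open>The triangle inequality for Alexandrov angles\<close>

text \<open>In the plane, put the vertices \<open>s e^(ia)\<close> and \<open>t e^(-ib)\<close> on both sides of the
  positive real axis; \<open>y\<close> is where the side between them crosses the axis.\<close>

lemma split_euclidean_triangle:
  fixes a b s t :: real
  assumes ab: "0 < a" "0 < b" "a + b < pi" and st: "0 < s" "0 < t"
  obtains y where "0 < y" "y \<le> max s t"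
    "sqrt (s\<^sup>2 + y\<^sup>2 - 2 * s * y * cos a) + sqrt (y\<^sup>2 + t\<^sup>2 - 2 * y * t * cos b)
      = sqrt (s\<^sup>2 + t\<^sup>2 - 2 * s * t * cos (a + b))"
proof -
  have sin: "0 < sin a" "0 < sin b" "0 < sin (a + b)"
    using ab by (auto intro!: sin_gt_zero)
  define S where "S = s * sin a + t * sin b"
  have S: "S > 0" using sin st by (simp add: S_def add_pos_pos)
  \<comment> \<open>This weight balances the imaginary parts:
    \<open>k * s * sin a = (1 - k) * t * sin b\<close>.\<close>
  define k where "k = t * sin b / S"
  have k: "0 < k" "1 - k = s * sin a / S"
    using S sin st by (auto simp: k_def field_simps S_def)
  have k1: "0 < 1 - k" unfolding k(2) using S sin st by simp
  define P where "P = complex_of_real s * cis a"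
  define Q where "Q = complex_of_real t * cis (- b)"
  define Y where "Y = k *\<^sub>R P + (1 - k) *\<^sub>R Q"
  \<comment> \<open>The formula comes from areas: the triangles with apex angles \<open>a\<close>
    and \<open>b\<close> on the common side \<open>y\<close> add up to the one with apex angle
    \<open>a + b\<close>.\<close>
  define y where "y = s * t * sin (a + b) / S"
  have Yy: "Y = complex_of_real y"
  proof (rule complex_eqI)
    have "Re Y = k * s * cos a + (1 - k) * t * cos b"
      by (simp add: Y_def P_def Q_def)
    also have "\<dots> = y"
      unfolding k(2) unfolding k_def y_def using S by (simp add: sin_add field_simps)
    finally show "Re Y = Re (complex_of_real y)" by simp
    have "Im Y = k * s * sin a - (1 - k) * t * sin b"
      by (simp add: Y_def P_def Q_def)
    also have "\<dots> = 0"
      unfolding k(2) unfolding k_def using S by (simp add: field_simps)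
    finally show "Im Y = Im (complex_of_real y)" by simp
  qed
  have y: "0 < y" using sin st S by (simp add: y_def)
  have cmodPQ: "cmod P = s" "cmod Q = t"
    using st by (simp_all add: P_def Q_def norm_mult)
  have "y = cmod Y" using y Yy by simp
  also have "\<dots> \<le> k * s + (1 - k) * t"
    unfolding Y_def using k(1) k1 cmodPQ
    by (intro norm_triangle_le) simp
  also have "\<dots> \<le> k * max s t + (1 - k) * max s t"
    using k(1) k1 by (intro add_mono mult_left_mono) auto
  finally have "y \<le> max s t" by (simp add: algebra_simps)
  \<comment> \<open>Writing 1 as the sum of the squares of sine and cosine leaves a polynomial
    identity.\<close>
  have "(cmod (P - Y))\<^sup>2 = s\<^sup>2 * ((sin a)\<^sup>2 + (cos a)\<^sup>2) + y\<^sup>2 - 2 * s * y * cos a"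
    unfolding cmod_power2 by (simp add: Yy P_def power2_eq_square algebra_simps del: sin_cos_squared_add3)
  then have PY: "cmod (P - Y) = sqrt (s\<^sup>2 + y\<^sup>2 - 2 * s * y * cos a)"
    by (simp add: real_sqrt_unique)
  have "(cmod (Y - Q))\<^sup>2 = y\<^sup>2 + t\<^sup>2 * ((sin b)\<^sup>2 + (cos b)\<^sup>2) - 2 * y * t * cos b"
    unfolding cmod_power2 by (simp add: Yy Q_def power2_eq_square algebra_simps del: sin_cos_squared_add3)
  then have YQ: "cmod (Y - Q) = sqrt (y\<^sup>2 + t\<^sup>2 - 2 * y * t * cos b)"
    by (simp add: real_sqrt_unique)
  have "(cmod (P - Q))\<^sup>2 = s\<^sup>2 * ((sin a)\<^sup>2 + (cos a)\<^sup>2) + t\<^sup>2 * ((sin b)\<^sup>2 + (cos b)\<^sup>2)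
      - 2 * s * t * cos (a + b)"
    unfolding cmod_power2 by (simp add: P_def Q_def power2_eq_square algebra_simps cos_add del: sin_cos_squared_add3)
  then have PQ: "cmod (P - Q) = sqrt (s\<^sup>2 + t\<^sup>2 - 2 * s * t * cos (a + b))"
    by (simp add: real_sqrt_unique)
  \<comment> \<open>Since \<open>Y\<close> lies on the segment between \<open>P\<close> and
    \<open>Q\<close>, the two lengths add up.\<close>
  have "P - Y = (1 - k) *\<^sub>R (P - Q)" "Y - Q = k *\<^sub>R (P - Q)"
    by (simp_all add: Y_def algebra_simps)
  then have "cmod (P - Y) = (1 - k) * cmod (P - Q)" "cmod (Y - Q) = k * cmod (P - Q)"
    using k(1) k1 by simp_all
  then have "cmod (P - Y) + cmod (Y - Q) = cmod (P - Q)"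
    by (simp add: left_diff_distrib)
  with y \<open>y \<le> max s t\<close> show ?thesis
    using that unfolding PY YQ PQ by blast
qed

text \<open>Choose \<open>a\<close> and \<open>b\<close> slightly above the two angles. If
  \<open>a + b < pi\<close>, split the Euclidean triangle with sides \<open>s\<close>,
  \<open>t\<close> and angle \<open>a + b\<close> by the ray at angle \<open>a\<close>, and use the
  length \<open>y\<close> of the cut as parameter on the middle geodesic. Both parts bound distances
  in the space, and their sum bounds the distance between the outer points by the third Euclidean
  side.\<close>

lemma alexandrov_angle_triangle:
  fixes x :: "'a::metric_space"
  assumes g: "g \<in> nonconstant_geodesics x" and h: "h \<in> nonconstant_geodesics x"
    and f: "f \<in> nonconstant_geodesics x"
  shows "alexandrov_angle (snd g) (snd f)
    \<le> alexandrov_angle (snd g) (snd h) + alexandrov_angle (snd h) (snd f)"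
proof (rule field_le_epsilon)
  fix d0 :: real assume "d0 > 0"
  define d where "d = d0 / 2"
  have d: "d > 0" using \<open>d0 > 0\<close> by (simp add: d_def)
  define a where "a = alexandrov_angle (snd g) (snd h) + d"
  define b where "b = alexandrov_angle (snd h) (snd f) + d"
  have ab: "0 < a" "0 < b"
    using alexandrov_angle_nonneg[OF g h] alexandrov_angle_nonneg[OF h f] d
    by (auto simp: a_def b_def)
  have "alexandrov_angle (snd g) (snd f) \<le> a + b"
  proof (cases "a + b < pi")
    case False
    then show ?thesis using alexandrov_angle_le_pi[OF g f] by linarith
  next
    case True
    obtain e1 where e1: "e1 > 0" "\<And>s t. 0 < s \<Longrightarrow> s < e1 \<Longrightarrow> 0 < t \<Longrightarrow> t < e1 \<Longrightarrow>
        comparison_angle x (snd g s) (snd h t) < a"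
      using alexandrov_angle_lessD[OF g h, of a] d by (auto simp: a_def)
    obtain e2 where e2: "e2 > 0" "\<And>s t. 0 < s \<Longrightarrow> s < e2 \<Longrightarrow> 0 < t \<Longrightarrow> t < e2 \<Longrightarrow>
        comparison_angle x (snd h s) (snd f t) < b"
      using alexandrov_angle_lessD[OF h f, of b] d by (auto simp: b_def)
    define e where "e = Min {e1, e2, fst g, fst h, fst f}"
    have e: "e > 0" "e \<le> e1" "e \<le> e2" "e \<le> fst g" "e \<le> fst h" "e \<le> fst f"
      using e1(1) e2(1) g h f by (auto simp: e_def nonconstant_geodesics_def)
    note dg = nonconstant_geodesics_dist[of "fst g" "snd g" x, simplified, OF g]
    note dh = nonconstant_geodesics_dist[of "fst h" "snd h" x, simplified, OF h]
    note df = nonconstant_geodesics_dist[of "fst f" "snd f" x, simplified, OF f]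
    have "comparison_angle x (snd g s) (snd f t) \<le> a + b"
      if st: "0 < s" "s < e" "0 < t" "t < e" for s t
    proof -
      obtain y where y: "0 < y" "y \<le> max s t"
        "sqrt (s\<^sup>2 + y\<^sup>2 - 2 * s * y * cos a) + sqrt (y\<^sup>2 + t\<^sup>2 - 2 * y * t * cos b)
          = sqrt (s\<^sup>2 + t\<^sup>2 - 2 * s * t * cos (a + b))"
        by (rule split_euclidean_triangle[OF ab True st(1,3)])
      \<comment> \<open>This is why \<open>y\<close> was bounded by \<open>max s t\<close>: both
        angle estimates apply at \<open>y\<close>.\<close>
      have ye: "y < e" using y st by auto
      have "comparison_angle x (snd g s) (snd h y) \<le> a" "comparison_angle x (snd h y) (snd f t) \<le> b"
        using e1(2)[of s y] e2(2)[of y t] y st ye e by auto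
      then have "(dist (snd g s) (snd h y))\<^sup>2 \<le> s\<^sup>2 + y\<^sup>2 - 2 * s * y * cos a"
        "(dist (snd h y) (snd f t))\<^sup>2 \<le> y\<^sup>2 + t\<^sup>2 - 2 * y * t * cos b"
        using comparison_angle_le_iff[of x "snd g s" "snd h y" a]
          comparison_angle_le_iff[of x "snd h y" "snd f t" b]
          dg[of s] dh[of y] df[of t] y st ye e ab True by auto
      then have "dist (snd g s) (snd h y) \<le> sqrt (s\<^sup>2 + y\<^sup>2 - 2 * s * y * cos a)"
        "dist (snd h y) (snd f t) \<le> sqrt (y\<^sup>2 + t\<^sup>2 - 2 * y * t * cos b)"
        by (auto intro: real_le_rsqrt)
      then have le: "dist (snd g s) (snd f t) \<le> sqrt (s\<^sup>2 + t\<^sup>2 - 2 * s * t * cos (a + b))"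
        using y(3) dist_triangle[of "snd g s" "snd f t" "snd h y"] by linarith
      \<comment> \<open>As \<open>sqrt\<close> takes negative values on negative reals, the radicand
        must be shown nonnegative before squaring.\<close>
      then have "0 \<le> sqrt (s\<^sup>2 + t\<^sup>2 - 2 * s * t * cos (a + b))"
        using zero_le_dist order_trans by blast
      then have "0 \<le> s\<^sup>2 + t\<^sup>2 - 2 * s * t * cos (a + b)" by simp
      then have "(dist (snd g s) (snd f t))\<^sup>2 \<le> s\<^sup>2 + t\<^sup>2 - 2 * s * t * cos (a + b)"
        using power_mono[OF le, of 2] by simp
      then show ?thesis
        using comparison_angle_le_iff[of x "snd g s" "snd f t" "a + b"]
          dg[of s] df[of t] st e ab True by auto
    qed
    then show ?thesis by (rule alexandrov_angle_leI[OF g f e(1)])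
  qed
  then show "alexandrov_angle (snd g) (snd f)
      \<le> alexandrov_angle (snd g) (snd h) + alexandrov_angle (snd h) (snd f) + d0"
    by (simp add: a_def b_def d_def)
qed

section \<open>Angles between directions and products of tangent vectors\<close>

text \<open>By the triangle inequality, replacing a geodesic by one at angle 0 does not change its
  angles. Each geodesic lies in its own class, so the value selected by \<open>THE\<close> is
  unique.\<close>

lemma direction_angle_eq:
  fixes x :: "'a::metric_space"
  assumes g: "g \<in> nonconstant_geodesics x" and h: "h \<in> nonconstant_geodesics x"
  shows "direction_angle (direction x g) (direction x h) = alexandrov_angle (snd g) (snd h)"
  unfolding direction_angle_def
proof (rule the_equality)
  show "\<forall>g'\<in>direction x g. \<forall>h'\<in>direction x h.
      alexandrov_angle (snd g') (snd h') = alexandrov_angle (snd g) (snd h)"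
  proof (intro ballI)
    fix g' h' assume "g' \<in> direction x g" "h' \<in> direction x h"
    then have g': "g' \<in> nonconstant_geodesics x" "alexandrov_angle (snd g) (snd g') = 0"
      and h': "h' \<in> nonconstant_geodesics x" "alexandrov_angle (snd h) (snd h') = 0"
      by (auto simp: direction_def same_direction_def)
    then have "alexandrov_angle (snd g') (snd g) = 0" "alexandrov_angle (snd h') (snd h) = 0"
      using alexandrov_angle_commute g h by metis+
    then show "alexandrov_angle (snd g') (snd h') = alexandrov_angle (snd g) (snd h)"
      using alexandrov_angle_triangle[OF g'(1) g h'(1)] alexandrov_angle_triangle[OF g h h'(1)]
        alexandrov_angle_triangle[OF g g'(1) h] alexandrov_angle_triangle[OF g'(1) h'(1) h] g' h'
      by linarith
  qed
next
  fix a assume "\<forall>g'\<in>direction x g. \<forall>h'\<in>direction x h. alexandrov_angle (snd g') (snd h') = a"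
  moreover have "g \<in> direction x g" "h \<in> direction x h"
    using g h alexandrov_angle_self[OF g] alexandrov_angle_self[OF h]
    by (auto simp: direction_def same_direction_def)
  ultimately show "a = alexandrov_angle (snd g) (snd h)" by metis
qed

lemma tangent_pair_in_tangent_space:
  assumes "g \<in> nonconstant_geodesics x" "0 \<le> r"
  shows "tangent_pair x g r \<in> tangent_space x"
  using assms
  unfolding tangent_pair_def tangent_space_def euclidean_cone_def space_of_directions_def direction_def
  by (blast intro: quotientI)

text \<open>This includes \<open>r = 0\<close>, where the second vector is \<open>Apex\<close> and
  both sides vanish.\<close>

lemma tangent_product_unit_left:
  fixes x :: "'a::metric_space"
  assumes "g \<in> nonconstant_geodesics x" "h \<in> nonconstant_geodesics x"
  shows "tangent_product (tangent_pair x g 1) (tangent_pair x h r)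
    = r * cos (alexandrov_angle (snd g) (snd h))"
  using direction_angle_eq[OF assms] by (simp add: tangent_pair_def cone_pair_def)

section \<open>CAT(0) inequalities\<close>

text \<open>Put the first vertex at the origin and the second on the first axis. The law of cosines
  forces the first coordinate \<open>u\<close> of the third vertex, and the triangle inequalities
  give \<open>\<bar>u\<bar> \<le> b\<close>, so the second coordinate is real. The case
  \<open>p = q\<close> is separate because \<open>u\<close> divides by \<open>a\<close>.\<close>

lemma euclidean_triangle_exists:
  fixes p q r :: "'a::metric_space"
  obtains p' q' r' :: "real^2" where
    "dist p' q' = dist p q" "dist p' r' = dist p r" "dist q' r' = dist q r"
proof (cases "p = q")
  case True
  show ?thesis
    using that[of 0 0 "dist p r *\<^sub>R axis 1 1"] True by (simp add: norm_axis_1)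
next
  case False
  define a b c where "a = dist p q" and "b = dist p r" and "c = dist q r"
  have a: "a > 0" using False by (simp add: a_def)
  define u where "u = (a\<^sup>2 + b\<^sup>2 - c\<^sup>2) / (2 * a)"
  have "c\<^sup>2 \<le> (a + b)\<^sup>2"
    by (rule power_mono) (use dist_triangle3[of q r p] in \<open>auto simp: a_def b_def c_def\<close>)
  moreover have "(a - b)\<^sup>2 \<le> c\<^sup>2"
    unfolding abs_le_square_iff[symmetric] a_def b_def c_def
    using dist_triangle[of p q r] dist_triangle[of p r q] by (simp add: dist_commute abs_le_iff)
  ultimately have "\<bar>a\<^sup>2 + b\<^sup>2 - c\<^sup>2\<bar> \<le> b * (2 * a)"
    by (simp add: abs_le_iff power2_sum power2_diff mult.commute mult.left_commute)
  then have "\<bar>u\<bar> \<le> b" using a by (simp add: u_def abs_mult pos_divide_le_eq)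
  then have ub: "u\<^sup>2 \<le> b\<^sup>2"
    using abs_le_square_iff[of u b] by (simp add: b_def)
  define v where "v = sqrt (b\<^sup>2 - u\<^sup>2)"
  have v: "v\<^sup>2 = b\<^sup>2 - u\<^sup>2" using ub by (simp add: v_def)
  have ua: "2 * a * u = a\<^sup>2 + b\<^sup>2 - c\<^sup>2" using a by (simp add: u_def)
  define q' r' :: "real^2" where "q' = vector [a, 0]" and "r' = vector [u, v]"
  have "(a - u)\<^sup>2 + v\<^sup>2 = c\<^sup>2" using ua v by (simp add: power2_diff)
  then have "dist q' r' = c"
    by (simp add: dist_norm norm_vec_def L2_set_def sum_2 q'_def r'_def c_def)
  moreover have "dist 0 q' = a" "dist 0 r' = b"
    using a v by (simp_all add: norm_vec_def L2_set_def sum_2 q'_def r'_def b_def)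
  ultimately show ?thesis using that[of 0 q' r'] by (simp add: a_def b_def c_def)
qed

text \<open>The distance of the comparison points is that of two multiples of the side vectors
  \<open>v\<close> and \<open>w\<close>. Expanding it, with the inner product expressed by the side
  lengths, removes the comparison triangle from the CAT(0) inequality.\<close>

lemma CAT0_dist_le:
  fixes p q r :: "'a::metric_space"
  assumes cat: "CAT0 TYPE('a)"
    and \<gamma>: "geodesic (dist p q) \<gamma>" "\<gamma> 0 = p" "\<gamma> (dist p q) = q"
    and \<eta>: "geodesic (dist p r) \<eta>" "\<eta> 0 = p" "\<eta> (dist p r) = r"
    and s: "0 \<le> s" "s \<le> 1" and t: "0 \<le> t" "t \<le> 1"
  shows "(dist (\<gamma> (s * dist p q)) (\<eta> (t * dist p r)))\<^sup>2
    \<le> s\<^sup>2 * (dist p q)\<^sup>2 + t\<^sup>2 * (dist p r)\<^sup>2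
      - s * t * ((dist p q)\<^sup>2 + (dist p r)\<^sup>2 - (dist q r)\<^sup>2)"
proof -
  obtain p' q' r' :: "real^2" where eq:
    "dist p' q' = dist p q" "dist p' r' = dist p r" "dist q' r' = dist q r"
    by (rule euclidean_triangle_exists)
  define v w where "v = q' - p'" and "w = r' - p'"
  define x' y' where "x' = p' + s *\<^sub>R v" and "y' = p' + t *\<^sub>R w"
  have nv: "norm v = dist p q" "norm w = dist p r"
    using eq by (metis dist_commute dist_norm v_def w_def)+
  have sq: "s * dist p q \<in> {0..dist p q}" and tr: "t * dist p r \<in> {0..dist p r}"
    using s t by (auto intro: mult_left_le_one_le)
  have seg: "geodesic_segment (\<gamma> ` {0..dist p q}) p q" "geodesic_segment (\<eta> ` {0..dist p r}) p r"
    using \<gamma> \<eta> unfolding geodesic_segment_def by blast+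
  have x': "x' \<in> closed_segment p' q'" "y' \<in> closed_segment p' r'"
    using s t by (auto simp: in_segment x'_def y'_def v_def w_def algebra_simps
        intro: exI[of _ s] exI[of _ t])
  have "dist p (\<gamma> (s * dist p q)) = s * dist p q" "dist p (\<eta> (t * dist p r)) = t * dist p r"
    using geodesic_dist[OF \<gamma>(1), of 0 "s * dist p q"] geodesic_dist[OF \<eta>(1), of 0 "t * dist p r"]
      \<gamma>(2) \<eta>(2) sq tr s t by auto
  moreover have "dist p' x' = s * dist p q" "dist p' y' = t * dist p r"
    using s t nv by (simp_all add: x'_def y'_def dist_norm)
  ultimately have le: "dist (\<gamma> (s * dist p q)) (\<eta> (t * dist p r)) \<le> dist x' y'"
    using cat[unfolded CAT0_def, THEN conjunct2, rule_format,
        of "\<gamma> ` {0..dist p q}" p q "\<eta> ` {0..dist p r}" r p' q' r'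
        "\<gamma> (s * dist p q)" "\<eta> (t * dist p r)" x' y'] seg eq x' sq tr
    by auto
  have "(dist q' r')\<^sup>2 = (norm (v - w))\<^sup>2"
    by (simp add: v_def w_def dist_norm)
  then have "(dist q r)\<^sup>2 = (norm v)\<^sup>2 + (norm w)\<^sup>2 - 2 * (v \<bullet> w)"
    using eq by (simp add: power2_norm_eq_inner inner_diff_left inner_diff_right inner_commute)
  then have vw: "2 * (v \<bullet> w) = (dist p q)\<^sup>2 + (dist p r)\<^sup>2 - (dist q r)\<^sup>2"
    using nv by simp
  have "(dist x' y')\<^sup>2 = (norm (s *\<^sub>R v - t *\<^sub>R w))\<^sup>2"
    by (simp add: x'_def y'_def dist_norm)
  also have "\<dots> = s\<^sup>2 * (norm v)\<^sup>2 + t\<^sup>2 * (norm w)\<^sup>2 - s * t * (2 * (v \<bullet> w))"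
    unfolding power2_norm_eq_inner
    by (simp add: inner_diff_left inner_diff_right inner_commute[of w v]
        power2_eq_square algebra_simps)
  finally show ?thesis
    using power_mono[OF le, of 2] vw nv by simp
qed

lemma CAT0_geodesic_exists:
  fixes p q :: "'a::metric_space"
  assumes "CAT0 TYPE('a)"
  obtains \<gamma> where "geodesic (dist p q) \<gamma>" "\<gamma> 0 = p" "\<gamma> (dist p q) = q"
proof -
  obtain S where "geodesic_segment S p q" using assms unfolding CAT0_def by blast
  then show ?thesis using that by (rule geodesic_segment_obtain)
qed

section \<open>Obtuse angles at projections and comparison of angles\<close>

text \<open>If the inequality failed by \<open>m > 0\<close>, moving from \<open>z\<close> towards
  \<open>y\<close> by the fraction \<open>s\<close> would change the squared distance to
  \<open>x\<close> by at most \<open>s^2 a^2 - s m\<close>. This is negative for small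
  \<open>s\<close>, although the moved point stays in \<open>D\<close>.\<close>

lemma CAT0_projection_obtuse:
  fixes x z :: "'a::metric_space"
  assumes cat: "CAT0 TYPE('a)" and cvx: "geodesically_convex D" and z: "z \<in> D" and y: "y \<in> D"
    and min: "\<And>y'. y' \<in> D \<Longrightarrow> dist x z \<le> dist x y'"
  shows "(dist x z)\<^sup>2 + (dist z y)\<^sup>2 \<le> (dist x y)\<^sup>2"
proof (rule ccontr)
  define a b c where "a = dist z y" and "b = dist z x" and "c = dist y x"
  define m where "m = a\<^sup>2 + b\<^sup>2 - c\<^sup>2"
  assume "\<not> ?thesis"
  then have m: "m > 0"
    by (simp add: m_def a_def b_def c_def dist_commute)
  obtain \<gamma> where \<gamma>: "geodesic (dist z y) \<gamma>" "\<gamma> 0 = z" "\<gamma> (dist z y) = y"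
    using CAT0_geodesic_exists[OF cat] by blast
  obtain \<eta> where \<eta>: "geodesic (dist z x) \<eta>" "\<eta> 0 = z" "\<eta> (dist z x) = x"
    using CAT0_geodesic_exists[OF cat] by blast
  have "s * m \<le> s * (s * a\<^sup>2)" if s: "0 < s" "s \<le> 1" for s
  proof -
    have "geodesic_segment (\<gamma> ` {0..dist z y}) z y"
      using \<gamma> unfolding geodesic_segment_def by blast
    then have "\<gamma> ` {0..dist z y} \<subseteq> D"
      using cvx z y unfolding geodesically_convex_def by blast
    moreover have "s * dist z y \<in> {0..dist z y}"
      using s by (auto intro: mult_left_le_one_le)
    ultimately have "\<gamma> (s * dist z y) \<in> D" by blast
    then have "b \<le> dist (\<gamma> (s * dist z y)) x"
      using min by (metis b_def dist_commute)
    then have "b\<^sup>2 \<le> (dist (\<gamma> (s * dist z y)) x)\<^sup>2"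
      by (rule power_mono) (simp add: b_def)
    \<comment> \<open>The comparison is based at \<open>z\<close>; the parameter 1 on the second
      side selects its endpoint \<open>x\<close>.\<close>
    also have "\<dots> \<le> s\<^sup>2 * a\<^sup>2 + b\<^sup>2 - s * m"
      using CAT0_dist_le[OF cat \<gamma> \<eta>, of s 1] s \<eta> by (simp add: a_def b_def c_def m_def)
    finally show ?thesis by (simp add: power2_eq_square)
  qed
  then have sm: "m \<le> s * a\<^sup>2" if "0 < s" "s \<le> 1" for s
    using that by (simp add: mult_le_cancel_left_pos)
  have "a\<^sup>2 > 0" using sm[of 1] m by linarith
  \<comment> \<open>With this choice \<open>s * a^2\<close> is at most \<open>m / 2\<close>,
    contradicting \<open>sm\<close>.\<close>
  define s where "s = min 1 (m / (2 * a\<^sup>2))"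
  have "0 < s" "s \<le> 1" using m \<open>a\<^sup>2 > 0\<close> by (auto simp: s_def)
  then have "m \<le> s * a\<^sup>2" by (rule sm)
  also have "\<dots> \<le> m / (2 * a\<^sup>2) * a\<^sup>2"
    by (intro mult_right_mono) (auto simp: s_def)
  also have "\<dots> = m / 2" using \<open>a\<^sup>2 > 0\<close> by simp
  finally show False using m by simp
qed

text \<open>By the law of cosines, \<open>CAT0_dist_le\<close> bounds the comparison angle of inner
  points of the two sides by that of the whole triangle. The bound passes to the upper
  limit.\<close>

lemma CAT0_alexandrov_angle_le:
  fixes p q r :: "'a::metric_space"
  assumes cat: "CAT0 TYPE('a)" and "p \<noteq> q" "p \<noteq> r"
    and \<gamma>: "geodesic (dist p q) \<gamma>" "\<gamma> 0 = p" "\<gamma> (dist p q) = q"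
    and \<eta>: "geodesic (dist p r) \<eta>" "\<eta> 0 = p" "\<eta> (dist p r) = r"
  shows "alexandrov_angle \<gamma> \<eta> \<le> comparison_angle p q r"
proof -
  have pos: "0 < dist p q" "0 < dist p r" using assms by auto
  have g: "(dist p q, \<gamma>) \<in> nonconstant_geodesics p" and h: "(dist p r, \<eta>) \<in> nonconstant_geodesics p"
    using \<gamma> \<eta> pos by (auto simp: nonconstant_geodesics_def)
  have "comparison_angle p (\<gamma> s) (\<eta> t) \<le> comparison_angle p q r"
    if "0 < s" "s < min (dist p q) (dist p r)" "0 < t" "t < min (dist p q) (dist p r)" for s t
  proof -
    note ds = nonconstant_geodesics_dist[OF g, of s] and dt = nonconstant_geodesics_dist[OF h, of t]
    have "(dist (\<gamma> (s / dist p q * dist p q)) (\<eta> (t / dist p r * dist p r)))\<^sup>2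
        \<le> (s / dist p q)\<^sup>2 * (dist p q)\<^sup>2 + (t / dist p r)\<^sup>2 * (dist p r)\<^sup>2
          - s / dist p q * (t / dist p r) * ((dist p q)\<^sup>2 + (dist p r)\<^sup>2 - (dist q r)\<^sup>2)"
      using that pos by (intro CAT0_dist_le[OF cat \<gamma> \<eta>]) auto
    also have "\<dots> = s\<^sup>2 + t\<^sup>2 - 2 * s * t * cos (comparison_angle p q r)"
      using pos assms by (simp add: cos_comparison_angle power_divide)
    finally have "(dist (\<gamma> s) (\<eta> t))\<^sup>2 \<le> s\<^sup>2 + t\<^sup>2 - 2 * s * t * cos (comparison_angle p q r)"
      using pos by simp
    then show ?thesis
      using comparison_angle_le_iff[of p "\<gamma> s" "\<eta> t" "comparison_angle p q r"] ds dt that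
        cos_comparison_angle[OF assms(2,3)] by auto
  qed
  then show ?thesis
    using alexandrov_angle_leI[OF g h, of "min (dist p q) (dist p r)"] pos by simp
qed

section \<open>Geodesics and lines through two given points\<close>

lemma geodesic_to_nonconstant:
  fixes x y :: "'a::metric_space"
  assumes "CAT0 TYPE('a)" "x \<noteq> y"
  shows "geodesic_to x y \<in> nonconstant_geodesics x"
    and "geodesic (dist x y) (snd (geodesic_to x y))" "snd (geodesic_to x y) 0 = x"
    "snd (geodesic_to x y) (dist x y) = y"
proof -
  have "\<exists>\<gamma>. geodesic (dist x y) \<gamma> \<and> \<gamma> 0 = x \<and> \<gamma> (dist x y) = y"
    using CAT0_geodesic_exists[OF assms(1)] by metis
  from someI_ex[OF this] show "geodesic (dist x y) (snd (geodesic_to x y))"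
    "snd (geodesic_to x y) 0 = x" "snd (geodesic_to x y) (dist x y) = y"
    by (auto simp: geodesic_to_def)
  then show "geodesic_to x y \<in> nonconstant_geodesics x"
    using assms(2) by (auto simp: nonconstant_geodesics_def geodesic_to_def)
qed

text \<open>The extending line meets \<open>x\<close> and \<open>z\<close> at some parameters
  \<open>u\<close> and \<open>v\<close>; it is shifted to start at \<open>x\<close> and reversed if
  necessary.\<close>

lemma geodesic_line_through:
  fixes x z :: "'a::metric_space"
  assumes cat: "CAT0 TYPE('a)" and ext: "geodesic_extension_property TYPE('a)" and "x \<noteq> z"
  obtains c :: "real \<Rightarrow> 'a" where "\<And>s t. dist (c s) (c t) = \<bar>s - t\<bar>" "c 0 = x" "c (dist x z) = z"
proof -
  obtain S where S: "geodesic_segment S x z" using cat unfolding CAT0_def by blast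
  then obtain L where "geodesic_line L" "S \<subseteq> L"
    using ext assms(3) unfolding geodesic_extension_property_def by blast
  then obtain c :: "real \<Rightarrow> 'a" where c: "\<And>s t. dist (c s) (c t) = \<bar>s - t\<bar>" "S \<subseteq> range c"
    unfolding geodesic_line_def by blast
  have "x \<in> S" "z \<in> S" using S unfolding geodesic_segment_def geodesic_def by force+
  then obtain u v where uv: "c u = x" "c v = z" using c(2) by blast
  \<comment> \<open>The sign orients the line from \<open>x\<close> towards
    \<open>z\<close>.\<close>
  define k where "k = sgn (v - u)"
  have "u \<noteq> v" using uv assms(3) by auto
  then have k: "\<bar>k\<bar> = 1" by (simp add: k_def abs_sgn_eq)
  have "u + k * dist x z = v"
    using c(1)[of u v] uv by (simp add: k_def abs_minus_commute[of u v] sgn_mult_abs)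
  moreover have "dist (c (u + k * s)) (c (u + k * t)) = \<bar>s - t\<bar>" for s t
    using c(1) k by (simp add: right_diff_distrib[symmetric] abs_mult)
  ultimately show ?thesis
    using that[of "\<lambda>t. c (u + k * t)"] uv by simp
qed

section \<open>Separation\<close>

text \<open>Points on the two sides of \<open>c 0\<close> have distance \<open>s + t\<close>, so
  every comparison triangle is degenerate with angle \<open>pi\<close>.\<close>

lemma line_opposite_directions:
  fixes c :: "real \<Rightarrow> 'a::metric_space"
  assumes c: "\<And>s t. dist (c s) (c t) = \<bar>s - t\<bar>" and l: "0 < l" "0 < l'"
  shows "(l, \<lambda>t. c (- t)) \<in> nonconstant_geodesics (c 0)" "(l', c) \<in> nonconstant_geodesics (c 0)"
    and "alexandrov_angle (\<lambda>t. c (- t)) c = pi"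
proof -
  show g: "(l, \<lambda>t. c (- t)) \<in> nonconstant_geodesics (c 0)"
    and h: "(l', c) \<in> nonconstant_geodesics (c 0)"
    using l c by (auto simp: nonconstant_geodesics_def geodesic_def)
  have "pi \<le> comparison_angle (c 0) (c (- s)) (c t)" if "0 < s" "0 < t" for s t
  proof -
    have "dist (c 0) (c (- s)) = s" "dist (c 0) (c t) = t" "dist (c (- s)) (c t) = s + t"
      using c that by simp_all
    moreover have "s\<^sup>2 + t\<^sup>2 - (s + t)\<^sup>2 = - (2 * s * t)"
      by (simp add: power2_sum)
    ultimately show ?thesis using that by (simp add: comparison_angle_def)
  qed
  then show "alexandrov_angle (\<lambda>t. c (- t)) c = pi"
    using alexandrov_angle_geI[OF g h, of 1 pi] alexandrov_angle_le_pi[OF g h] by simp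
qed

theorem corollary4p23:
  fixes C D :: "'a::complete_space set"
  assumes "CAT0 TYPE('a)"
    and "locally compact (UNIV :: 'a set)"
    and "geodesic_extension_property TYPE('a)"
    and "C \<noteq> {}" "geodesically_convex C" "closed C"
    and "D \<noteq> {}" "geodesically_convex D" "closed D"
    and "C \<inter> D = {}"
    and "bounded C \<or> bounded D"
  shows "\<exists>x\<in>C. \<exists>g\<in>nonconstant_geodesics x. \<exists>h\<in>nonconstant_geodesics x.
    tangent_pair x g 1 \<in> tangent_space x \<and>
    tangent_pair x h 1 \<in> tangent_space x \<and>
    opposite (tangent_pair x g 1) (tangent_pair x h 1) \<and>
    (SUP y\<in>D. ereal (tangent_product (tangent_pair x g 1)
       (tangent_pair x (geodesic_to x y) (dist x y)))) < 0 \<and>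
    (SUP y\<in>C. ereal (tangent_product (tangent_pair x h 1)
       (tangent_pair x (geodesic_to x y) (dist x y)))) \<le> 0"
proof -
  note cat = \<open>CAT0 TYPE('a)\<close>
  have "\<exists>S. geodesic_segment S a b" for a b :: 'a
    using cat unfolding CAT0_def by blast
  then have "compact (cball p r)" for p :: 'a and r
    using Hopf_Rinow_compact_cball[OF _ assms(2)] by blast
  then obtain x z where x: "x \<in> C" and z: "z \<in> D"
    and min: "\<And>x' z'. x' \<in> C \<Longrightarrow> z' \<in> D \<Longrightarrow> dist x z \<le> dist x' z'"
    using closest_points_bounded_closed[of C D] assms by metis
  define L where "L = dist x z"
  have "x \<noteq> z" using x z assms(10) by blast
  then have L: "L > 0" by (simp add: L_def)
  obtain c :: "real \<Rightarrow> 'a" where c: "\<And>s t. dist (c s) (c t) = \<bar>s - t\<bar>" "c 0 = x" "c L = z"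
    using geodesic_line_through[OF cat assms(3) \<open>x \<noteq> z\<close>] unfolding L_def by blast
  \<comment> \<open>The length 1 is arbitrary, as only the angle at \<open>x\<close> matters. The
    geodesic \<open>h\<close> ends at \<open>z\<close>, so it is a side of the triangle
    \<open>x\<close>, \<open>z\<close>, \<open>y\<close> below.\<close>
  define g where "g = (1::real, \<lambda>t. c (- t))"
  define h where "h = (L, c)"
  have g: "g \<in> nonconstant_geodesics x" and h: "h \<in> nonconstant_geodesics x"
    and gh: "alexandrov_angle (snd g) (snd h) = pi"
    using line_opposite_directions[of c 1 L] c L by (auto simp: g_def h_def)
  have opp: "opposite (tangent_pair x g 1) (tangent_pair x h 1)"
    unfolding opposite_def using direction_angle_eq[OF g h] gh
    by (auto simp: tangent_pair_def cone_pair_def)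
  have "tangent_product (tangent_pair x g 1) (tangent_pair x (geodesic_to x y) (dist x y)) \<le> - L"
    if y: "y \<in> D" for y
  proof -
    let ?f = "geodesic_to x y" and ?d = "dist x y"
    have "x \<noteq> y" using x y assms(10) by blast
    then have d: "?d > 0" by simp
    note f = geodesic_to_nonconstant[OF cat \<open>x \<noteq> y\<close>]
    have "L\<^sup>2 + (dist z y)\<^sup>2 \<le> ?d\<^sup>2"
      unfolding L_def by (rule CAT0_projection_obtuse[OF cat assms(8) z y min[OF x]])
    \<comment> \<open>The obtuse angle at \<open>z\<close> becomes, by the law of cosines at
      \<open>x\<close>, a lower bound \<open>L / ?d\<close> for the cosine of the comparison angle
      there.\<close>
    then have "2 * L\<^sup>2 \<le> L\<^sup>2 + ?d\<^sup>2 - (dist z y)\<^sup>2" by simp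
    then have "2 * L\<^sup>2 / (2 * L * ?d) \<le> (L\<^sup>2 + ?d\<^sup>2 - (dist z y)\<^sup>2) / (2 * L * ?d)"
      using L d by (intro divide_right_mono) auto
    also have "\<dots> = cos (comparison_angle x z y)"
      using cos_comparison_angle(1)[OF \<open>x \<noteq> z\<close> \<open>x \<noteq> y\<close>] by (simp add: L_def)
    also have "\<dots> \<le> cos (alexandrov_angle (snd h) (snd ?f))"
    proof (rule cos_monotone_0_pi_le)
      have "geodesic (dist x z) c" using c(1) L by (auto simp: geodesic_def)
      then show "alexandrov_angle (snd h) (snd ?f) \<le> comparison_angle x z y"
        using CAT0_alexandrov_angle_le[OF cat \<open>x \<noteq> z\<close> \<open>x \<noteq> y\<close> _ _ _ f(2-4), of c] c(2,3)
        by (simp add: h_def L_def)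
    qed (use alexandrov_angle_nonneg[OF h f(1)] cos_comparison_angle(3)[OF \<open>x \<noteq> z\<close> \<open>x \<noteq> y\<close>] in auto)
    finally have "L / ?d \<le> cos (alexandrov_angle (snd h) (snd ?f))"
      using L by (simp add: power2_eq_square)
    \<comment> \<open>As \<open>g\<close> and \<open>h\<close> form the angle \<open>pi\<close>, the
      angles of \<open>?f\<close> with them add up to at least \<open>pi\<close>.\<close>
    moreover have "cos (alexandrov_angle (snd g) (snd ?f))
        \<le> cos (pi - alexandrov_angle (snd h) (snd ?f))"
    proof (rule cos_monotone_0_pi_le)
      show "pi - alexandrov_angle (snd h) (snd ?f) \<le> alexandrov_angle (snd g) (snd ?f)"
        using alexandrov_angle_triangle[OF g f(1) h] alexandrov_angle_commute[OF f(1) h] gh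
        by linarith
    qed (use alexandrov_angle_le_pi[OF g f(1)] alexandrov_angle_le_pi[OF h f(1)] in auto)
    ultimately have "cos (alexandrov_angle (snd g) (snd ?f)) \<le> - (L / ?d)"
      by simp
    then have "?d * cos (alexandrov_angle (snd g) (snd ?f)) \<le> ?d * - (L / ?d)"
      using d by (intro mult_left_mono) auto
    then show ?thesis
      using tangent_product_unit_left[OF g f(1)] d by simp
  qed
  \<comment> \<open>The bound \<open>- L\<close> is the same for all \<open>y\<close>, which makes
    the supremum strictly negative.\<close>
  then have "(SUP y\<in>D. ereal (tangent_product (tangent_pair x g 1)
      (tangent_pair x (geodesic_to x y) (dist x y)))) \<le> ereal (- L)"
    by (intro SUP_least) simp
  also have "\<dots> < 0" using L by simp
  finally have supD: "(SUP y\<in>D. ereal (tangent_product (tangent_pair x g 1)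
      (tangent_pair x (geodesic_to x y) (dist x y)))) < 0" .
  have "tangent_product (tangent_pair x h 1) (tangent_pair x (geodesic_to x y) (dist x y)) \<le> 0"
    if y: "y \<in> C" for y
  proof (cases "x = y")
    case True
    then show ?thesis by (simp add: tangent_pair_def cone_pair_def)
  next
    case False
    let ?f = "geodesic_to x y" and ?d = "dist x y"
    have d: "?d > 0" using False by simp
    note f = geodesic_to_nonconstant[OF cat False]
    have fC: "snd ?f ` {0..?d} \<subseteq> C"
      using assms(5) x y f(2-4) unfolding geodesically_convex_def geodesic_segment_def by blast
    have "pi / 2 \<le> comparison_angle x (snd h s) (snd ?f t)"
      if st: "0 < s" "s < min L ?d" "0 < t" "t < min L ?d" for s t
    proof -
      \<comment> \<open>The point \<open>c s\<close> has distance \<open>s\<close> from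
        \<open>x\<close> and \<open>L - s\<close> from \<open>z\<close>. A point of \<open>C\<close>
        closer to it than \<open>x\<close> would have distance less than \<open>L\<close> from
        \<open>z\<close>.\<close>
      have "dist (c s) x \<le> dist (c s) y'" if "y' \<in> C" for y'
        using min[OF that z] dist_triangle[of y' z "c s"] c(1)[of s L] c(1)[of s 0] c(2,3) st
        by (simp add: L_def dist_commute)
      \<comment> \<open>Here \<open>x\<close> is the projection of \<open>c s\<close> to
        \<open>C\<close>, and the comparison angle at \<open>x\<close> is seen to be at least a
        right angle.\<close>
      then have "(dist (c s) x)\<^sup>2 + (dist x (snd ?f t))\<^sup>2 \<le> (dist (c s) (snd ?f t))\<^sup>2"
        using fC st by (intro CAT0_projection_obtuse[OF cat assms(5) x]) auto
      then have "(dist x (c s))\<^sup>2 + (dist x (snd ?f t))\<^sup>2 - (dist (c s) (snd ?f t))\<^sup>2 \<le> 0"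
        by (simp add: dist_commute)
      moreover have ne: "x \<noteq> c s" "x \<noteq> snd ?f t"
        using nonconstant_geodesics_dist(2)[of L c x s]
          nonconstant_geodesics_dist(2)[of ?d "snd ?f" x t] h f(1) st
        by (auto simp: h_def geodesic_to_def)
      ultimately have "cos (comparison_angle x (c s) (snd ?f t)) \<le> cos (pi / 2)"
        by (simp add: cos_comparison_angle divide_nonpos_nonneg)
      then show ?thesis
        using cos_comparison_angle(2,3)[OF ne] cos_mono_le_eq by (simp add: h_def del: cos_pi_half)
    qed
    then have "pi / 2 \<le> alexandrov_angle (snd h) (snd ?f)"
      using L d by (intro alexandrov_angle_geI[OF h f(1), of "min L ?d"]) auto
    then have "cos (alexandrov_angle (snd h) (snd ?f)) \<le> cos (pi / 2)"
      using alexandrov_angle_le_pi[OF h f(1)] by (intro cos_monotone_0_pi_le) auto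
    then show ?thesis
      using tangent_product_unit_left[OF h f(1)] d by (simp add: mult_nonneg_nonpos)
  qed
  then have "(SUP y\<in>C. ereal (tangent_product (tangent_pair x h 1)
      (tangent_pair x (geodesic_to x y) (dist x y)))) \<le> 0"
    by (intro SUP_least) simp
  with x g h opp supD show ?thesis
    using tangent_pair_in_tangent_space[OF g, of 1] tangent_pair_in_tangent_space[OF h, of 1] by auto
qed

end
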